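(* Let $(i)$ and $(j)$ be two observations with scaled legitimate features $z_1^{(i)},\dots,z_L^{(i)}\in[0,1]$ and $z_1^{(j)},\dots,z_L^{(j)}\in[0,1]$, and let $\varepsilon\ge 0$. If $(i)$ and $(j)$ are $\varepsilon$-similar, that is, $$d''(i,j)=\sum_{\ell=1}^L \omega_\ell\,(1-\widetilde{\rho}_\ell)\,\bigl|z_\ell^{(i)}-z_\ell^{(j)}\bigr|=\varepsilon,$$ then $$\bigl|d''(i,\star)-d''(j,\star)\bigr|\le\varepsilon,$$ where $d''(i,\star)=\sum_{\ell=1}^L \omega_\ell\,(1-\widetilde{\rho}_\ell)\,\bigl(1-z_\ell^{(i)}\bigr)$ is the weighted distance of an observation to the North Star $(\star)$.
   Context: Each observation has $L$ legitimate features which have been rescaled (from a data set $\mathcal{D}$ by min-max normalization, with $z\mapsto 1-z$ applied to features for which lower values are beneficial) to values $z_\ell^{(i)}\in[0,1]$, $\ell\in\{1,\dots,L\}$. The North Star $(\star)$ is the (potentially hypothetical) observation with $z_\ell^{(\star)}=1$ for all $\ell$. The feature importances are real numbers $\omega_1,\dots,\omega_L\ge 0$ with $\sum_{\ell=1}^L\omega_\ell=1$. The numbers $\widetilde{\rho}_\ell\in[0,1]$ are given by $\widetilde{\rho}_\ell=\max_{k\in\{1,\dots,K\}}|\rho_{a_k,z_\ell}|$, where $a_1,\dots,a_K$ are the protected features in $\mathcal{D}$ and $\rho_{a_k,z_\ell}$ is Spearman's rank correlation coefficient between the samples $a_k$ and $z_\ell$ over $\mathcal{D}$. *)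

theory Defs
  imports Complex_Main
begin

text \<open>
  A data set is a finite set \<open>D\<close> of observations; a feature (sample) over it is a real function on
  the observations, so distinct observations may have equal feature values.
  A constant feature, for which min-max normalization is mathematically undefined, is sent to \<open>0\<close>.
\<close>

definition min_max :: "'o set \<Rightarrow> ('o \<Rightarrow> real) \<Rightarrow> 'o \<Rightarrow> real" where
  "min_max D f n = (f n - Min (f ` D)) / (Max (f ` D) - Min (f ` D))"

text \<open>
  \<open>x l\<close> is the raw \<open>l\<close>-th legitimate feature and \<open>B\<close> the set of those feature indices for which
  lower values are beneficial.
\<close>

definition scaled :: "'o set \<Rightarrow> nat set \<Rightarrow> (nat \<Rightarrow> 'o \<Rightarrow> real) \<Rightarrow> nat \<Rightarrow> 'o \<Rightarrow> real" where
  "scaled D B x l n = (if l \<in> B then 1 - min_max D (x l) n else min_max D (x l) n)"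

text \<open>
  Ranks start at 1, and tied values share the average of the positions they occupy.
\<close>

definition rank :: "'o set \<Rightarrow> ('o \<Rightarrow> real) \<Rightarrow> 'o \<Rightarrow> real" where
  "rank D f n = real (card {m \<in> D. f m < f n}) + (real (card {m \<in> D. f m = f n}) + 1) / 2"

definition mean :: "'o set \<Rightarrow> ('o \<Rightarrow> real) \<Rightarrow> real" where
  "mean D f = (\<Sum>n\<in>D. f n) / real (card D)"

text \<open>
  The normalizing factors \<open>1 / card D\<close> of covariance and variances cancel.  For a constant sample,
  where the coefficient is mathematically undefined, the value is \<open>0 / 0 = 0\<close>.
\<close>

definition pearson :: "'o set \<Rightarrow> ('o \<Rightarrow> real) \<Rightarrow> ('o \<Rightarrow> real) \<Rightarrow> real" where
  "pearson D f g =
     (\<Sum>n\<in>D. (f n - mean D f) * (g n - mean D g)) /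
     (sqrt (\<Sum>n\<in>D. (f n - mean D f)\<^sup>2) * sqrt (\<Sum>n\<in>D. (g n - mean D g)\<^sup>2))"

definition spearman :: "'o set \<Rightarrow> ('o \<Rightarrow> real) \<Rightarrow> ('o \<Rightarrow> real) \<Rightarrow> real" where
  "spearman D f g = pearson D (rank D f) (rank D g)"

definition max_abs_spearman :: "'o set \<Rightarrow> nat \<Rightarrow> (nat \<Rightarrow> 'o \<Rightarrow> real) \<Rightarrow> ('o \<Rightarrow> real) \<Rightarrow> real" where
  "max_abs_spearman D K a f = Max ((\<lambda>k. \<bar>spearman D (a k) f\<bar>) ` {1..K})"

text \<open>
  The distance compares observations through their vectors of scaled legitimate features, so that
  it applies to hypothetical observations such as the North Star as well.
\<close>

definition weighted_dist ::
  "nat \<Rightarrow> (nat \<Rightarrow> real) \<Rightarrow> (nat \<Rightarrow> real) \<Rightarrow> (nat \<Rightarrow> real) \<Rightarrow> (nat \<Rightarrow> real) \<Rightarrow> real" where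
  "weighted_dist L \<omega> \<rho> u v = (\<Sum>l=1..L. \<omega> l * (1 - \<rho> l) * \<bar>u l - v l\<bar>)"

definition north_star :: "nat \<Rightarrow> real" where
  "north_star = (\<lambda>l. 1)"

lemma weighted_dist_north_star:
  assumes "\<And>l. l \<in> {1..L} \<Longrightarrow> z l \<in> {0..1}"
  shows "weighted_dist L \<omega> \<rho> z north_star = (\<Sum>l=1..L. \<omega> l * (1 - \<rho> l) * (1 - z l))"
  unfolding weighted_dist_def north_star_def
proof (rule sum.cong)
  fix l assume "l \<in> {1..L}"
  with assms have "z l \<le> 1" by fastforce
  then show "\<omega> l * (1 - \<rho> l) * \<bar>z l - 1\<bar> = \<omega> l * (1 - \<rho> l) * (1 - z l)" by simp
qed simp

end

theory Submission
  imports Defs "HOL-Analysis.L2_Norm"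
begin

text \<open>With nonnegative weights, \<open>weighted_dist\<close> is a weighted L1 pseudometric, so
  it obeys the reverse triangle inequality coordinate by coordinate
  (\<open>weighted_dist_reverse_triangle\<close>); the North Star is simply taken as the third
  point. What remains is that the weights \<open>\<omega> l * (1 - \<rho> l)\<close> are
  nonnegative. This needs \<open>\<rho> l \<le> 1\<close>, which is derived from the definition of
  Spearman's coefficient: it is a Pearson coefficient of ranks, hence bounded by Cauchy-Schwarz
  (\<open>abs_pearson_le_1\<close>).\<close>

lemma abs_pearson_le_1: "\<bar>pearson D f g\<bar> \<le> 1"
proof -
  define u v where "u n = f n - mean D f" and "v n = g n - mean D g" for n
  have "\<bar>\<Sum>n\<in>D. u n * v n\<bar> \<le> (\<Sum>n\<in>D. \<bar>u n\<bar> * \<bar>v n\<bar>)"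
    by (rule order_trans[OF sum_abs]) (simp add: abs_mult)
  also have "\<dots> \<le> L2_set u D * L2_set v D"
    by (rule L2_set_mult_ineq)
  finally have le: "\<bar>\<Sum>n\<in>D. u n * v n\<bar> \<le> L2_set u D * L2_set v D" .
  have "\<bar>pearson D f g\<bar> = \<bar>\<Sum>n\<in>D. u n * v n\<bar> / (L2_set u D * L2_set v D)"
    by (simp add: pearson_def u_def v_def L2_set_def abs_mult sum_nonneg)
  \<comment> \<open>If a sample is constant, the denominator is 0 and the quotient is 0 by
    convention, so this case satisfies the bound too.\<close>
  also have "\<dots> \<le> 1"
    using le by (intro divide_le_eq_1[THEN iffD2]) (auto simp: less_le)
  finally show ?thesis .
qed

text \<open>Every element under the maximum is an absolute Pearson coefficient.
  \<open>K \<ge> 1\<close> makes the index set nonempty, without which \<open>Max\<close> is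
  unspecified.\<close>

lemma max_abs_spearman_le_1:
  assumes "K \<ge> 1"
  shows "max_abs_spearman D K a f \<le> 1"
  using assms by (simp add: max_abs_spearman_def spearman_def abs_pearson_le_1)

lemma weighted_dist_reverse_triangle:
  assumes "\<And>l. l \<in> {1..L} \<Longrightarrow> \<omega> l \<ge> 0" and "\<And>l. l \<in> {1..L} \<Longrightarrow> \<rho> l \<le> 1"
  shows "\<bar>weighted_dist L \<omega> \<rho> u w - weighted_dist L \<omega> \<rho> v w\<bar> \<le> weighted_dist L \<omega> \<rho> u v"
proof -
  have "\<bar>weighted_dist L \<omega> \<rho> u w - weighted_dist L \<omega> \<rho> v w\<bar>
      = \<bar>\<Sum>l=1..L. \<omega> l * (1 - \<rho> l) * (\<bar>u l - w l\<bar> - \<bar>v l - w l\<bar>)\<bar>"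
    by (simp add: weighted_dist_def sum_subtractf right_diff_distrib)
  also have "\<dots> \<le> (\<Sum>l=1..L. \<bar>\<omega> l * (1 - \<rho> l) * (\<bar>u l - w l\<bar> - \<bar>v l - w l\<bar>)\<bar>)"
    by (rule sum_abs)
  also have "\<dots> \<le> weighted_dist L \<omega> \<rho> u v"
    unfolding weighted_dist_def
  proof (rule sum_mono)
    fix l assume "l \<in> {1..L}"
    with assms have "0 \<le> \<omega> l * (1 - \<rho> l)" by simp
    then have "\<bar>\<omega> l * (1 - \<rho> l) * (\<bar>u l - w l\<bar> - \<bar>v l - w l\<bar>)\<bar>
        = \<omega> l * (1 - \<rho> l) * \<bar>\<bar>u l - w l\<bar> - \<bar>v l - w l\<bar>\<bar>"
      \<comment> \<open>Splitting only the outermost product keeps the weight in one piece, so its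
        nonnegativity applies directly.\<close>
      by (subst abs_mult) (simp only: abs_of_nonneg)
    \<comment> \<open>The reverse triangle inequality on the reals: \<open>w l\<close> cancels in
      the difference of \<open>u l - w l\<close> and \<open>v l - w l\<close>.\<close>
    also have "\<dots> \<le> \<omega> l * (1 - \<rho> l) * \<bar>u l - v l\<bar>"
      using \<open>0 \<le> \<omega> l * (1 - \<rho> l)\<close> by (intro mult_left_mono) auto
    finally show "\<bar>\<omega> l * (1 - \<rho> l) * (\<bar>u l - w l\<bar> - \<bar>v l - w l\<bar>)\<bar>
        \<le> \<omega> l * (1 - \<rho> l) * \<bar>u l - v l\<bar>" .
  qed
  finally show ?thesis .
qed

theorem proposition2:
  fixes D :: "'o set" and K L :: nat and B :: "nat set"
    and a x :: "nat \<Rightarrow> 'o \<Rightarrow> real"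
    and \<omega> \<rho> zi zj :: "nat \<Rightarrow> real" and \<epsilon> :: real
  assumes "finite D" and "D \<noteq> {}" and "K \<ge> 1"
    and "\<And>l. l \<in> {1..L} \<Longrightarrow> \<omega> l \<ge> 0" and "(\<Sum>l=1..L. \<omega> l) = 1"
    and "\<And>l. l \<in> {1..L} \<Longrightarrow> \<rho> l = max_abs_spearman D K a (scaled D B x l)"
    and "\<And>l. l \<in> {1..L} \<Longrightarrow> zi l \<in> {0..1}"
    and "\<And>l. l \<in> {1..L} \<Longrightarrow> zj l \<in> {0..1}"
    and "\<epsilon> \<ge> 0"
    and "weighted_dist L \<omega> \<rho> zi zj = \<epsilon>"
  shows "\<bar>weighted_dist L \<omega> \<rho> zi north_star - weighted_dist L \<omega> \<rho> zj north_star\<bar> \<le> \<epsilon>"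
proof -
  have "\<rho> l \<le> 1" if "l \<in> {1..L}" for l
    using assms(6)[OF that] max_abs_spearman_le_1[OF \<open>K \<ge> 1\<close>] by simp
  from weighted_dist_reverse_triangle[of L \<omega> \<rho>, OF assms(4) this]
  show ?thesis
    unfolding assms(10)[symmetric] .
qed

end
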